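(* Let $\lambda>0$ and let $\Theta$ be a real random variable with exponential probability density $P_\Theta(\theta)=\lambda e^{-\lambda\theta}$ for $\theta\ge 0$ (and $0$ for $\theta<0$). Let $R(D)$ be the rate-distortion function of $\Theta$ (in bits) under the distortion measure $d(\theta,\hat\theta)=|\theta-\hat\theta|$, and let $D(R)$ be the corresponding distortion-rate function. Then for every $D>0$, $$R(D)\ge -\log_2(2\lambda D).$$ Equivalently, for every rate $R\ge 0$, $$D(R)\ge\frac{1}{\lambda\,2^{R+1}}.$$
   Context: For a real-valued random variable $\Theta$ and the distortion measure $d(\theta,\hat\theta)=|\theta-\hat\theta|$, the rate-distortion function is $$R(D)=\inf_{P_{\hat\Theta|\Theta}:\ \mathbb{E}[|\Theta-\hat\Theta|]\le D} I(\Theta;\hat\Theta),$$ where the infimum is over all conditional distributions $P_{\hat\Theta|\Theta}$ of a real-valued reconstruction $\hat\Theta$ given $\Theta$, and $I(\Theta;\hat\Theta)$ is the mutual information measured in bits (logarithms to base $2$). The distortion-rate function is $D(R)=\inf\{D: R(D)\le R\}$. (In the paper's application, $\Theta$ is the magnitude of a model parameter and $\hat\Theta$ its quantized version.) *)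

theory Defs
  imports "HOL-Probability.Probability"
begin

text \<open>
  The library's real-valued \<^const>\<open>prob_space.mutual_information\<close> has a meaningful value only if
  the joint law is absolutely continuous with respect to the product of the marginals and the
  log-density is integrable under the joint law. In all other cases mutual information is
  \<open>+\<infinity>\<close>: the negative part of the log-density is always integrable under the joint law, so
  non-integrability means that the integral diverges to \<open>+\<infinity>\<close>. The extended-real version below
  records this; it matters for an infimum over all joint laws, which includes
  the case of a reconstruction equal to the source.
\<close>

definition mutual_information_ext ::
  "real \<Rightarrow> 'a measure \<Rightarrow> 'b measure \<Rightarrow> 'c measure \<Rightarrow> ('a \<Rightarrow> 'b) \<Rightarrow> ('a \<Rightarrow> 'c) \<Rightarrow> ereal"
where
  "mutual_information_ext b M S T X Y =
     (let P = distr M S X \<Otimes>\<^sub>M distr M T Y;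
          Q = distr M (S \<Otimes>\<^sub>M T) (\<lambda>\<omega>. (X \<omega>, Y \<omega>))
      in if absolutely_continuous P Q \<and> integrable Q (entropy_density b P Q)
         then ereal (prob_space.mutual_information M b S T X Y)
         else \<infinity>)"

definition joint_law :: "real measure \<Rightarrow> (real \<Rightarrow> real measure) \<Rightarrow> (real \<times> real) measure"
where
  "joint_law P K = P \<bind> (\<lambda>x. K x \<bind> (\<lambda>y. return (borel \<Otimes>\<^sub>M borel) (x, y)))"

text \<open>
  \<open>P\<close> is the law of the source. The conditional laws of the reconstruction given the source are
  the Markov kernels \<open>K\<close> on the real line. An infeasible constraint gives \<open>Inf {} = \<infinity>\<close>; the
  expected distortion is compared in \<^typ>\<open>ereal\<close>, so that this includes every \<open>D < 0\<close>.
\<close>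

definition rate_distortion :: "real measure \<Rightarrow> real \<Rightarrow> ereal"
where
  "rate_distortion P D =
     (INF K \<in> {K \<in> borel \<rightarrow>\<^sub>M prob_algebra borel.
                enn2ereal (\<integral>\<^sup>+ z. ennreal \<bar>fst z - snd z\<bar> \<partial>joint_law P K) \<le> ereal D}.
        mutual_information_ext 2 (joint_law P K) borel borel fst snd)"

definition distortion_rate :: "real measure \<Rightarrow> real \<Rightarrow> ereal"
where
  "distortion_rate P R = Inf {ereal D | D. rate_distortion P D \<le> ereal R}"

end

theory Submission
  imports Defs
begin

text \<open>
  Write \<open>\<Theta>'\<close> for the reconstruction. Gibbs' inequality bounds the divergence of the joint law from the product of its marginals from
  below by the expectation of \<open>log g\<close> under the joint law, for every positive \<open>g\<close> whose integral
  against the product is at most \<open>1\<close>. Take \<open>g(x, y)\<close> to be the Laplace density of scale \<open>D\<close>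
  centred at \<open>y\<close>, evaluated at \<open>x\<close>, divided by the exponential density at \<open>x\<close>. The expectation of
  \<open>ln g\<close> is \<open>\<lambda> E[\<Theta>] - E|\<Theta> - \<Theta>'| / D - ln (2 \<lambda> D)\<close>, which is at least \<open>- ln (2 \<lambda> D)\<close> since
  \<open>E[\<Theta>] = 1 / \<lambda>\<close>.
\<close>

section \<open>Gibbs' inequality and the Laplace density\<close>

text \<open>With \<open>f\<close> the density of \<open>Q\<close> with respect to \<open>Z\<close>,
  integrate \<open>ln t \<le> t - 1\<close> at \<open>t = g / f\<close> against \<open>Q\<close>.
  The expectation of \<open>g / f\<close> under \<open>Q\<close> is at most the integral of
  \<open>g\<close> against \<open>Z\<close>, hence at most 1.\<close>

lemma KL_divergence_ge_integral_log:
  fixes g :: "'a \<Rightarrow> real"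
  assumes b: "b > 1"
    and "sigma_finite_measure Z" and "prob_space Q"
    and ac: "absolutely_continuous Z Q" and sets: "sets Q = sets Z"
    and int: "integrable Q (entropy_density b Z Q)"
    and g: "g \<in> borel_measurable Z" and g_pos: "\<And>z. g z > 0"
    and g_le: "(\<integral>\<^sup>+ z. ennreal (g z) \<partial>Z) \<le> 1"
    and int_g: "integrable Q (\<lambda>z. log b (g z))"
  shows "(\<integral>z. log b (g z) \<partial>Q) \<le> KL_divergence b Z Q"
proof -
  interpret Z: sigma_finite_measure Z by fact
  interpret Q: prob_space Q by fact
  define f where "f = (\<lambda>z. enn2real (RN_deriv Z Q z))"
  have f[measurable]: "f \<in> borel_measurable Z" unfolding f_def by measurable
  note g[measurable]
  have dens: "density Z (RN_deriv Z Q) = Q"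
    by (rule Z.density_RN_deriv[OF ac sets])
  have "AE z in Z. RN_deriv Z Q z \<noteq> \<infinity>"
    by (rule Z.RN_deriv_finite[OF _ ac sets]) unfold_locales
  hence fin: "AE z in Z. RN_deriv Z Q z = ennreal (f z)"
    by eventually_elim (simp add: f_def less_top)
  have Qf: "Q = density Z (\<lambda>z. ennreal (f z))"
    by (subst dens[symmetric], rule density_cong) (use fin in auto)
  have [measurable]: "f \<in> borel_measurable Q" "g \<in> borel_measurable Q"
    using f g by (simp_all add: measurable_cong_sets[OF sets refl])
  have f_nonneg: "f z \<ge> 0" for z by (simp add: f_def)
  \<comment> \<open>The set where \<open>f\<close> vanishes is null for \<open>Q\<close>, since
    \<open>f\<close> is the density of \<open>Q\<close>.\<close>
  have f_pos: "AE z in Q. f z > 0"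
    by (subst Qf, subst AE_density) auto
  have "(\<integral>\<^sup>+ z. ennreal (g z / f z) \<partial>Q) = (\<integral>\<^sup>+ z. ennreal (f z) * ennreal (g z / f z) \<partial>Z)"
    by (subst Qf, subst nn_integral_density) auto
  \<comment> \<open>Only an inequality: where \<open>f z = 0\<close>, division by zero gives 0, so
    the integrand on the left vanishes while \<open>g z\<close> is positive.\<close>
  also have "\<dots> \<le> (\<integral>\<^sup>+ z. ennreal (g z) \<partial>Z)"
    by (intro nn_integral_mono)
       (use f_nonneg g_pos in \<open>auto simp: ennreal_mult[symmetric] less_imp_le\<close>)
  finally have ratio_le: "(\<integral>\<^sup>+ z. ennreal (g z / f z) \<partial>Q) \<le> 1"
    using g_le by (rule order_trans)
  have ratio_nonneg: "g z / f z \<ge> 0" for z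
    using f_nonneg[of z] g_pos[of z] by simp
  have int_ratio: "integrable Q (\<lambda>z. g z / f z)"
    using ratio_le ratio_nonneg
    by (intro integrableI_nonneg) (auto intro: le_less_trans)
  have "(\<integral>z. g z / f z \<partial>Q) = enn2real (\<integral>\<^sup>+ z. ennreal (g z / f z) \<partial>Q)"
    using ratio_nonneg by (intro integral_eq_nn_integral) auto
  also have "\<dots> \<le> 1"
    using enn2real_mono[OF ratio_le] by simp
  finally have ratio_le': "(\<integral>z. g z / f z \<partial>Q) \<le> 1" .
  have int': "integrable Q (\<lambda>z. log b (f z))"
    using int by (simp add: entropy_density_def f_def comp_def)
  have "(\<integral>z. log b (g z) - log b (f z) \<partial>Q) \<le> (\<integral>z. (g z / f z - 1) / ln b \<partial>Q)"
  proof (rule integral_mono_AE)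
    show "AE z in Q. log b (g z) - log b (f z) \<le> (g z / f z - 1) / ln b"
      using f_pos
    proof eventually_elim
      fix z assume "f z > 0"
      hence "ln (g z) - ln (f z) \<le> g z / f z - 1"
        using ln_le_minus_one[of "g z / f z"] g_pos[of z] by (simp add: ln_div)
      thus "log b (g z) - log b (f z) \<le> (g z / f z - 1) / ln b"
        using b by (simp add: log_def diff_divide_distrib[symmetric] divide_right_mono)
    qed
  qed (use int_g int' int_ratio in auto)
  also have "\<dots> = ((\<integral>z. g z / f z \<partial>Q) - 1) / ln b"
    using int_ratio by (simp add: Q.prob_space)
  also have "\<dots> \<le> 0"
    using ratio_le' b by (intro divide_nonpos_pos) auto
  finally have "(\<integral>z. log b (g z) \<partial>Q) \<le> (\<integral>z. log b (f z) \<partial>Q)"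
    using int_g int' by simp
  thus ?thesis
    by (simp add: KL_divergence_def entropy_density_def f_def comp_def)
qed

text \<open>The Laplace density is dominated by the average of two exponential densities of rate
  \<open>1 / s\<close>, one running to the right from \<open>y\<close> and one to the left, each of
  total mass 1.\<close>

lemma nn_integral_laplace_density_le:
  fixes s y :: real
  assumes "s > 0"
  shows "(\<integral>\<^sup>+ x. ennreal (exp (- \<bar>x - y\<bar> / s) / (2 * s)) \<partial>lborel) \<le> 1"
proof -
  let ?e = "exponential_density (1 / s)"
  have exp_int: "(\<integral>\<^sup>+ x. ennreal (?e x) \<partial>lborel) = 1"
  proof -
    interpret prob_space "density lborel ?e"
      using assms by (intro prob_space_exponential_density) simp
    show ?thesis using emeasure_space_1 by (simp add: emeasure_density)
  qed
  have e_nonneg: "?e x \<ge> 0" for x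
    using assms by (simp add: exponential_density_def)
  \<comment> \<open>Equality holds except at \<open>x = y\<close>, where both exponential densities
    contribute. The arguments are written as \<open>t + c * x\<close> to match
    \<open>nn_integral_real_affine\<close>.\<close>
  have "exp (- \<bar>x - y\<bar> / s) / (2 * s) \<le> 1/2 * ?e (- y + 1 * x) + 1/2 * ?e (y + (- 1) * x)" for x
    using assms by (cases x y rule: linorder_cases)
      (auto simp: exponential_density_def intro!: divide_left_mono)
  hence "ennreal (exp (- \<bar>x - y\<bar> / s) / (2 * s))
      \<le> ennreal (1/2) * ennreal (?e (- y + 1 * x)) + ennreal (1/2) * ennreal (?e (y + (- 1) * x))" for x
    using e_nonneg
    by (simp only: ennreal_mult[symmetric] ennreal_plus[symmetric] ennreal_leI
          mult_nonneg_nonneg zero_le_divide_1_iff zero_le_numeral)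
  hence "(\<integral>\<^sup>+ x. ennreal (exp (- \<bar>x - y\<bar> / s) / (2 * s)) \<partial>lborel)
      \<le> (\<integral>\<^sup>+ x. ennreal (1/2) * ennreal (?e (- y + 1 * x))
              + ennreal (1/2) * ennreal (?e (y + (- 1) * x)) \<partial>lborel)"
    by (intro nn_integral_mono)
  also have "\<dots> = ennreal (1/2) * (\<integral>\<^sup>+ x. ennreal (?e (- y + 1 * x)) \<partial>lborel)
              + ennreal (1/2) * (\<integral>\<^sup>+ x. ennreal (?e (y + (- 1) * x)) \<partial>lborel)"
    by (subst nn_integral_add) (auto simp: nn_integral_cmult)
  also have "(\<integral>\<^sup>+ x. ennreal (?e (- y + 1 * x)) \<partial>lborel) = 1"
    using nn_integral_real_affine[of "\<lambda>x. ennreal (?e x)" 1 "- y"] exp_int by simp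
  also have "(\<integral>\<^sup>+ x. ennreal (?e (y + (- 1) * x)) \<partial>lborel) = 1"
    using nn_integral_real_affine[of "\<lambda>x. ennreal (?e x)" "- 1" y] exp_int by simp
  also have "ennreal (1/2) * 1 + ennreal (1/2) * 1 = 1"
    by (simp only: mult_1_right ennreal_plus[symmetric] zero_le_divide_1_iff zero_le_numeral) simp
  finally show ?thesis by simp
qed

section \<open>The joint law of source and reconstruction\<close>

context
  fixes P :: "real measure" and K :: "real \<Rightarrow> real measure"
  assumes P_prob: "P \<in> space (prob_algebra borel)"
    and K_meas[measurable]: "K \<in> borel \<rightarrow>\<^sub>M prob_algebra borel"
begin

lemma joint_law_in_prob_algebra:
  "joint_law P K \<in> space (prob_algebra (borel \<Otimes>\<^sub>M borel))"
proof -
  have "(\<lambda>P. joint_law P K) \<in> prob_algebra borel \<rightarrow>\<^sub>M prob_algebra (borel \<Otimes>\<^sub>M borel)"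
    unfolding joint_law_def by measurable
  thus ?thesis using P_prob by (rule measurable_space)
qed

lemma prob_space_joint_law: "prob_space (joint_law P K)"
  and sets_joint_law: "sets (joint_law P K) = sets (borel \<Otimes>\<^sub>M borel)"
  using joint_law_in_prob_algebra by (auto simp: space_prob_algebra)

text \<open>Pushing \<open>fst\<close> through both binds leaves the constant kernel
  \<open>return borel x\<close> under \<open>K x\<close>, which collapses because \<open>K x\<close>
  has mass 1. This makes the mean of the first coordinate under the joint law that of the
  source.\<close>

lemma distr_fst_joint_law: "distr (joint_law P K) borel fst = P"
proof -
  have P: "prob_space P" "sets P = sets borel"
    using P_prob by (auto simp: space_prob_algebra)
  have PM[simp]: "measurable P N = measurable borel N" for N :: "'c measure"
    using P(2) by (rule measurable_cong_sets) simp
  have ne: "space P \<noteq> {}" using prob_space.not_empty[OF P(1)] .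
  have K_prob: "prob_space (K x)" "sets (K x) = sets borel" for x
    using measurable_space[OF K_meas, of x] by (auto simp: space_prob_algebra)
  have KM[simp]: "measurable (K x) N = measurable borel N" for N :: "'c measure" and x
    using K_prob(2) by (rule measurable_cong_sets) simp
  have K': "K \<in> borel \<rightarrow>\<^sub>M subprob_algebra borel"
    by (rule measurable_prob_algebraD) (rule K_meas)
  have inner: "(\<lambda>x. K x \<bind> (\<lambda>y. return (borel \<Otimes>\<^sub>M borel) (x, y)))
      \<in> borel \<rightarrow>\<^sub>M subprob_algebra (borel \<Otimes>\<^sub>M borel)"
    by (rule measurable_prob_algebraD) measurable
  have "distr (joint_law P K) borel fst
      = P \<bind> (\<lambda>x. distr (K x \<bind> (\<lambda>y. return (borel \<Otimes>\<^sub>M borel) (x, y))) borel fst)"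
    unfolding joint_law_def using ne inner
    by (intro distr_bind[where K="borel \<Otimes>\<^sub>M borel"]) auto
  also have "\<dots> = P \<bind> return borel"
  proof (intro arg_cong[where f="bind P"] ext)
    fix x
    have "distr (K x \<bind> (\<lambda>y. return (borel \<Otimes>\<^sub>M borel) (x, y))) borel fst
        = K x \<bind> (\<lambda>y. distr (return (borel \<Otimes>\<^sub>M borel) (x, y)) borel fst)"
      using prob_space.not_empty[OF K_prob(1)]
      by (intro distr_bind[where K="borel \<Otimes>\<^sub>M borel"]) auto
    also have "\<dots> = K x \<bind> (\<lambda>y. return borel x)"
      by (simp add: distr_return space_pair_measure)
    also have "\<dots> = return borel x"
      using K_prob(1) by (intro bind_const' prob_space_imp_subprob_space prob_space_return) auto
    finally show "distr (K x \<bind> (\<lambda>y. return (borel \<Otimes>\<^sub>M borel) (x, y))) borel fst = return borel x" .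
  qed
  also have "\<dots> = P" using P(2) by (rule bind_return'')
  finally show ?thesis .
qed

end

section \<open>The lower bounds for the exponential source\<close>

text \<open>An infinite mutual information satisfies the bound trivially. Otherwise it is the
  divergence of \<open>J\<close> from the product \<open>Z\<close> of its marginals, and Gibbs'
  inequality applies.\<close>

lemma mutual_information_exponential_ge:
  fixes l D :: real
  assumes "l > 0" "D > 0"
    and P_def: "P = density lborel (exponential_density l)"
    and K: "K \<in> borel \<rightarrow>\<^sub>M prob_algebra borel"
    and dist: "(\<integral>\<^sup>+ z. ennreal \<bar>fst z - snd z\<bar> \<partial>joint_law P K) \<le> ennreal D"
  shows "ereal (- log 2 (2 * l * D)) \<le> mutual_information_ext 2 (joint_law P K) borel borel fst snd"
proof -
  define J where "J = joint_law P K"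
  define \<nu> where "\<nu> = distr J borel snd"
  define Z where "Z = P \<Otimes>\<^sub>M \<nu>"
  have P_prob: "prob_space P"
    unfolding P_def using \<open>l > 0\<close> by (rule prob_space_exponential_density)
  have P_alg: "P \<in> space (prob_algebra borel)"
    using P_prob by (simp add: space_prob_algebra P_def)
  interpret P: prob_space P by fact
  interpret J: prob_space J
    unfolding J_def using P_alg K by (rule prob_space_joint_law)
  have sets_J: "sets J = sets (borel \<Otimes>\<^sub>M borel)"
    unfolding J_def using P_alg K by (rule sets_joint_law)
  have JM[simp]: "measurable J N = measurable (borel \<Otimes>\<^sub>M borel) N" for N :: "'c measure"
    using sets_J by (rule measurable_cong_sets) simp
  have fst_J: "distr J borel fst = P"
    unfolding J_def using P_alg K by (rule distr_fst_joint_law)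
  interpret \<nu>: prob_space \<nu>
    unfolding \<nu>_def by (rule J.prob_space_distr) simp
  interpret Z: pair_prob_space P \<nu> ..
  have sets_P: "sets P = sets borel" and sets_\<nu>: "sets \<nu> = sets borel"
    by (simp_all add: P_def \<nu>_def)
  have sets_Z: "sets Z = sets (borel \<Otimes>\<^sub>M borel)"
    unfolding Z_def by (intro sets_pair_measure_cong sets_P sets_\<nu>)
  have ZM[simp]: "measurable Z N = measurable (borel \<Otimes>\<^sub>M borel) N" for N :: "'c measure"
    using sets_Z by (rule measurable_cong_sets) simp
  \<comment> \<open>The pair \<open>(fst z, snd z)\<close> in the mutual information is
    \<open>z\<close> itself, so its law is \<open>J\<close>.\<close>
  have distr_J: "distr J (borel \<Otimes>\<^sub>M borel) (\<lambda>z. z) = J"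
    using sets_J by (intro distr_id2) simp

  have int_dist: "integrable J (\<lambda>z. \<bar>fst z - snd z\<bar>)"
    using dist by (intro integrableI_nonneg) (auto simp: J_def[symmetric] intro: le_less_trans)
  have "ennreal (\<integral>z. \<bar>fst z - snd z\<bar> \<partial>J) \<le> ennreal D"
    using dist by (subst nn_integral_eq_integral[symmetric, OF int_dist]) (auto simp: J_def)
  hence dist': "(\<integral>z. \<bar>fst z - snd z\<bar> \<partial>J) \<le> D"
    using \<open>D > 0\<close> by simp

  have distrib: "distributed P lborel (\<lambda>x. x) (exponential_density l)"
    unfolding distributed_def
    by (auto simp: P_def distr_id2 exponential_density_def[abs_def])
  have mean: "(\<integral>x. x \<partial>P) = 1 / l"
    using P.exponential_distributed_expectation[OF \<open>l > 0\<close> distrib] by simp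
  have int_x: "integrable P (\<lambda>x. x)"
    \<comment> \<open>The integral of a non-integrable function is 0 by default, which contradicts
      the mean \<open>1 / l\<close>.\<close>
    by (rule ccontr) (use mean \<open>l > 0\<close> in \<open>simp add: not_integrable_integral_eq\<close>)
  have int_fst: "integrable J fst"
    by (rule integrable_distr[of fst J borel "\<lambda>x. x"]) (simp, simp only: fst_J int_x)
  have mean_fst: "(\<integral>z. fst z \<partial>J) = 1 / l"
    unfolding mean[symmetric] fst_J[symmetric]
    by (rule integral_distr[symmetric]) simp_all

  \<comment> \<open>The factor \<open>exp (l * fst z) / l\<close> is the reciprocal of the
    exponential density on the half-line. It is kept for negative \<open>fst z\<close> too, so that
    \<open>g\<close> is positive everywhere.\<close>
  define g :: "real \<times> real \<Rightarrow> real"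
    where "g z = exp (- \<bar>fst z - snd z\<bar> / D) / (2 * D) * (exp (l * fst z) / l)" for z
  have g_pos: "g z > 0" for z
    using \<open>l > 0\<close> \<open>D > 0\<close> by (simp add: g_def)
  have g_meas[measurable]: "g \<in> borel_measurable (borel \<Otimes>\<^sub>M borel)"
    unfolding g_def by measurable
  have "(\<integral>\<^sup>+ z. ennreal (g z) \<partial>Z) = (\<integral>\<^sup>+ y. \<integral>\<^sup>+ x. ennreal (g (x, y)) \<partial>P \<partial>\<nu>)"
    unfolding Z_def
    by (rule Z.nn_integral_snd[symmetric]) (simp add: Z_def[symmetric])
  also have "\<dots> \<le> (\<integral>\<^sup>+ y. 1 \<partial>\<nu>)"
  proof (rule nn_integral_mono)
    fix y
    have "(\<integral>\<^sup>+ x. ennreal (g (x, y)) \<partial>P)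
        = (\<integral>\<^sup>+ x. ennreal (exponential_density l x) * ennreal (g (x, y)) \<partial>lborel)"
      unfolding P_def by (rule nn_integral_density) auto
    \<comment> \<open>For \<open>x \<ge> 0\<close> the exponential density cancels; for
      \<open>x < 0\<close> the left side is 0.\<close>
    also have "\<dots> \<le> (\<integral>\<^sup>+ x. ennreal (exp (- \<bar>x - y\<bar> / D) / (2 * D)) \<partial>lborel)"
      using \<open>l > 0\<close> \<open>D > 0\<close>
      by (intro nn_integral_mono)
         (auto simp: exponential_density_def g_def ennreal_mult[symmetric] exp_minus field_simps
               intro!: ennreal_leI)
    also have "\<dots> \<le> 1" using \<open>D > 0\<close> by (rule nn_integral_laplace_density_le)
    finally show "(\<integral>\<^sup>+ x. ennreal (g (x, y)) \<partial>P) \<le> 1" .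
  qed
  also have "\<dots> = 1" by (simp add: \<nu>.emeasure_space_1)
  finally have g_le: "(\<integral>\<^sup>+ z. ennreal (g z) \<partial>Z) \<le> 1" .

  have log_g: "log 2 (g z)
      = (l * fst z - \<bar>fst z - snd z\<bar> / D) / ln 2 - log 2 (2 * l * D)" for z
    using \<open>l > 0\<close> \<open>D > 0\<close>
    by (simp add: g_def log_def ln_mult ln_div diff_divide_distrib add_divide_distrib)
  have int_log_g: "integrable J (\<lambda>z. log 2 (g z))"
    unfolding log_g using int_fst int_dist by simp
  \<comment> \<open>The leading 1 is \<open>l\<close> times the mean \<open>1 / l\<close>.\<close>
  have "(\<integral>z. log 2 (g z) \<partial>J)
      = (1 - (\<integral>z. \<bar>fst z - snd z\<bar> \<partial>J) / D) / ln 2 - log 2 (2 * l * D)"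
    unfolding log_g using int_fst int_dist mean_fst \<open>l > 0\<close> by (simp add: J.prob_space)
  moreover have "(1 - (\<integral>z. \<bar>fst z - snd z\<bar> \<partial>J) / D) / ln 2 \<ge> 0"
    using dist' \<open>D > 0\<close> by simp
  ultimately have lower: "- log 2 (2 * l * D) \<le> (\<integral>z. log 2 (g z) \<partial>J)"
    by linarith

  have "- log 2 (2 * l * D) \<le> KL_divergence 2 Z J"
    if "absolutely_continuous Z J" "integrable J (entropy_density 2 Z J)"
  proof -
    have "(\<integral>z. log 2 (g z) \<partial>J) \<le> KL_divergence 2 Z J"
    proof (rule KL_divergence_ge_integral_log)
      show "sigma_finite_measure Z" unfolding Z_def by unfold_locales
      show "prob_space J" by unfold_locales
    qed (use that g_pos g_le int_log_g in \<open>auto simp: sets_J sets_Z\<close>)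
    with lower show ?thesis by linarith
  qed
  thus ?thesis
    unfolding mutual_information_ext_def J_def[symmetric] Let_def
    by (simp add: J.mutual_information_def distr_J fst_J \<nu>_def[symmetric] Z_def[symmetric])
qed

lemma rate_distortion_antimono:
  assumes "D \<le> D'"
  shows "rate_distortion P D' \<le> rate_distortion P D"
  unfolding rate_distortion_def
  by (rule INF_superset_mono) (use assms in \<open>auto intro: order_trans\<close>)

lemma rate_distortion_exponential_ge:
  assumes "l > 0" "D > 0"
  shows "ereal (- log 2 (2 * l * D))
    \<le> rate_distortion (density lborel (exponential_density l)) D"
  unfolding rate_distortion_def
proof (rule INF_greatest, clarify)
  let ?P = "density lborel (exponential_density l)"
  fix K assume K: "K \<in> borel \<rightarrow>\<^sub>M prob_algebra borel"
    and "enn2ereal (\<integral>\<^sup>+ z. ennreal \<bar>fst z - snd z\<bar> \<partial>joint_law ?P K) \<le> ereal D"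
  hence "(\<integral>\<^sup>+ z. ennreal \<bar>fst z - snd z\<bar> \<partial>joint_law ?P K) \<le> ennreal D"
    using \<open>D > 0\<close> by (simp add: less_eq_ennreal.rep_eq enn2ereal_ennreal)
  with assms K show "ereal (- log 2 (2 * l * D))
      \<le> mutual_information_ext 2 (joint_law ?P K) borel borel fst snd"
    by (intro mutual_information_exponential_ge) auto
qed

text \<open>The bound on the rate is strictly decreasing in the distortion, so any distortion below
  the threshold would force a rate above \<open>R\<close>.\<close>

lemma distortion_rate_exponential_ge:
  assumes "l > 0"
  shows "ereal (1 / (l * 2 powr (R + 1)))
    \<le> distortion_rate (density lborel (exponential_density l)) R"
  unfolding distortion_rate_def
proof (rule Inf_greatest, clarify)
  let ?P = "density lborel (exponential_density l)"
  fix D assume D: "rate_distortion ?P D \<le> ereal R"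
  \<comment> \<open>\<open>T\<close> is the distortion at which \<open>- log 2 (2 * l * T)\<close>
    equals \<open>R\<close>.\<close>
  define T where "T = 1 / (l * 2 powr (R + 1))"
  have "T > 0" using \<open>l > 0\<close> by (simp add: T_def)
  show "ereal (1 / (l * 2 powr (R + 1))) \<le> ereal D"
  proof (rule ccontr)
    assume "\<not> ?thesis"
    hence "D < T" by (simp add: T_def)
    \<comment> \<open>\<open>D\<close> itself may be nonpositive, where the bound on the rate does not apply.\<close>
    define D' where "D' = max D (T / 2)"
    have D': "D' > 0" "D' < T" "D \<le> D'"
      using \<open>D < T\<close> \<open>T > 0\<close> by (auto simp: D'_def)
    have "ereal (- log 2 (2 * l * D')) \<le> rate_distortion ?P D'"
      using \<open>l > 0\<close> D'(1) by (rule rate_distortion_exponential_ge)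
    also have "\<dots> \<le> rate_distortion ?P D"
      using D'(3) by (rule rate_distortion_antimono)
    also note D
    finally have "- R \<le> log 2 (2 * l * D')" by simp
    also have "\<dots> < log 2 (2 * l * T)"
      using D' \<open>T > 0\<close> \<open>l > 0\<close> by simp
    also have "2 * l * T = 2 powr (- R)"
      using \<open>l > 0\<close> by (simp add: T_def powr_add powr_minus field_simps)
    finally show False by simp
  qed
qed

theorem mainTheorem2:
  fixes M :: "'a measure" and \<Theta> :: "'a \<Rightarrow> real" and l :: real
  assumes "prob_space M"
    and "l > 0"
    and "distributed M lborel \<Theta> (\<lambda>\<theta>. ennreal (exponential_density l \<theta>))"
  shows "(\<forall>D::real. D > 0 \<longrightarrow>
            rate_distortion (distr M borel \<Theta>) D \<ge> ereal (- log 2 (2 * l * D))) \<and>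
         (\<forall>R::real. R \<ge> 0 \<longrightarrow>
            distortion_rate (distr M borel \<Theta>) R \<ge> ereal (1 / (l * 2 powr (R + 1))))"
proof -
  have "distr M borel \<Theta> = distr M lborel \<Theta>"
    by (rule distr_cong) auto
  also have "\<dots> = density lborel (exponential_density l)"
    using assms(3) by (rule distributed_distr_eq_density)
  finally show ?thesis
    using \<open>l > 0\<close> rate_distortion_exponential_ge distortion_rate_exponential_ge by simp
qed

end
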